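(* Let $\mu$ be a Borel probability measure on $\mathbb{R}^d$. Let $1<p,q<\infty$ and $\frac1p+\frac1q=1$. If $\nu$ is a $(p,q)$-Bessel measure for $\mu$, then there exists a constant $C$ such that $\nu(K)\le C\,\mathrm{diam}(K)^d$ for any compact subset $K$ of $\mathbb{R}^d$. Accordingly, $\nu$ is $\sigma$-finite.
   Context: For $t\in\mathbb{R}^d$ let $e_t(x)=e^{2\pi i t\cdot x}$. For a Borel probability measure $\mu$ on $\mathbb{R}^d$, $1<p<\infty$ and $f\in L^p(\mu)$, the compatible semi-inner product on $L^p(\mu)$ is $[f,g]_{L^p(\mu)}=\|g\|_{L^p(\mu)}^{2-p}\int f|g|^{p-1}\overline{\mathrm{sgn}(g)}\,d\mu$ for $\|g\|_{L^p(\mu)}\ne0$, and $0$ otherwise; it satisfies $[f,e_t]_{L^p(\mu)}=\int f(x)e^{-2\pi i t\cdot x}\,d\mu(x)$. For conjugate exponents $1<p,q<\infty$, a Borel measure $\nu$ on $\mathbb{R}^d$ is a $(p,q)$-Bessel measure for $\mu$ if there is a constant $B>0$ with $\int_{\mathbb{R}^d}|[f,e_t]_{L^p(\mu)}|^q\,d\nu(t)\le B\|f\|_{L^p(\mu)}^q$ for all $f\in L^p(\mu)$. $\mathrm{diam}(K)$ is the diameter of $K$.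
   Formalization: The bound proved is ν(K) ≤ C·max(1, diam(K))^d instead of C·diam(K)^d, because the printed bound fails for small sets: for μ = ν = δ_0 and K = {0}, ν is a Bessel measure, diam(K) = 0 and ν(K) = 1. *)

theory Defs
  imports "HOL-Probability.Probability"
begin

text \<open>Elements of \<open>L\<^sup>p(M)\<close> are represented by measurable complex-valued functions; all the notions
  below depend only on the almost-everywhere class.\<close>

definition in_Lp :: "real \<Rightarrow> 'a measure \<Rightarrow> ('a \<Rightarrow> complex) \<Rightarrow> bool" where
  "in_Lp p M f \<longleftrightarrow> f \<in> borel_measurable M \<and> integrable M (\<lambda>x. cmod (f x) powr p)"

definition Lp_norm :: "real \<Rightarrow> 'a measure \<Rightarrow> ('a \<Rightarrow> complex) \<Rightarrow> real" where
  "Lp_norm p M f = (\<integral>x. cmod (f x) powr p \<partial>M) powr (1 / p)"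

definition Lp_semi_inner ::
  "real \<Rightarrow> 'a measure \<Rightarrow> ('a \<Rightarrow> complex) \<Rightarrow> ('a \<Rightarrow> complex) \<Rightarrow> complex" where
  "Lp_semi_inner p M f g =
     (if Lp_norm p M g \<noteq> 0
      then of_real (Lp_norm p M g powr (2 - p)) *
             (\<integral>x. f x * of_real (cmod (g x) powr (p - 1)) * cnj (sgn (g x)) \<partial>M)
      else 0)"

definition e_fun :: "real ^ 'n \<Rightarrow> real ^ 'n \<Rightarrow> complex" where
  "e_fun t x = exp (2 * of_real pi * \<i> * of_real (t \<bullet> x))"

text \<open>A Borel measure is a measure on the Borel sigma-algebra; no finiteness on compact sets and no
  sigma-finiteness is assumed.\<close>

definition Bessel_measure ::
  "real \<Rightarrow> real \<Rightarrow> (real ^ 'n) measure \<Rightarrow> (real ^ 'n) measure \<Rightarrow> bool" where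
  "Bessel_measure p q \<mu> \<nu> \<longleftrightarrow>
     sets \<nu> = sets borel \<and>
     (\<exists>B>0. \<forall>f. in_Lp p \<mu> f \<longrightarrow>
        (\<integral>\<^sup>+t. ennreal (cmod (Lp_semi_inner p \<mu> f (e_fun t)) powr q) \<partial>\<nu>)
          \<le> ennreal (B * Lp_norm p \<mu> f powr q))"

end

theory Submission
  imports Defs
begin

text \<open>The reason is that the characters test the Bessel inequality on balls. The semi-inner product
  \<open>[e\<^sub>s, e\<^sub>t]\<close> is the Fourier transform of \<open>\<mu>\<close> at \<open>t - s\<close>. That transform is continuous and equals
  \<open>1\<close> at the origin, so there is a radius \<open>\<delta>\<close>, the same for every \<open>s\<close>, such that
  \<open>|[e\<^sub>s, e\<^sub>t]| \<ge> 1/2\<close> for all \<open>t\<close> in the ball of radius \<open>\<delta>\<close> about \<open>s\<close>. Since \<open>e\<^sub>s\<close> has norm \<open>1\<close>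
  in \<open>L\<^sup>p(\<mu>)\<close>, the Bessel inequality for \<open>f = e\<^sub>s\<close> bounds the \<open>\<nu>\<close>-measure of that ball by
  \<open>2\<^sup>q B\<close> (lemma \<open>Bessel_measure_uniform_ball_bound\<close>).

  A measure that is uniformly bounded on balls of one fixed radius grows at most like the volume at
  large scale: a set of diameter \<open>D\<close> is covered by \<open>O(max(1, D)\<^sup>d)\<close> such balls, centred on a grid
  (lemmas \<open>bounded_grid_cover\<close> and \<open>uniform_ball_bound_imp_growth\<close>). In particular \<open>\<nu>\<close> is finite on
  every ball, and the balls about any one point exhaust the space. The maximum with \<open>1\<close> is essential: the
  unit point mass at the origin is Bessel, by Hoelder's inequality, and it charges a set of
  diameter \<open>0\<close>.\<close>

lemma cmod_e_fun [simp]: "cmod (e_fun t x) = 1"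
proof -
  have "e_fun t x = exp (\<i> * of_real (2 * pi * (t \<bullet> x)))"
    by (simp add: e_fun_def mult_ac)
  then show ?thesis by (metis norm_exp_i_times)
qed

lemma e_fun_mult_cnj: "e_fun s x * cnj (e_fun t x) = e_fun (s - t) x"
  by (simp add: e_fun_def exp_cnj inner_diff_left flip: exp_add)
     (simp add: algebra_simps)

lemma borel_measurable_e_fun [measurable]: "e_fun t \<in> borel_measurable borel"
  unfolding e_fun_def by measurable

lemma e_fun_in_Lp:
  assumes "prob_space \<mu>" and "sets \<mu> = sets borel"
  shows "in_Lp p \<mu> (e_fun s)" and "Lp_norm p \<mu> (e_fun s) = 1"
proof -
  interpret prob_space \<mu> by fact
  have "e_fun s \<in> borel_measurable \<mu>"
    using borel_measurable_e_fun assms(2) measurable_cong_sets by blast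
  then show "in_Lp p \<mu> (e_fun s)" by (simp add: in_Lp_def)
  show "Lp_norm p \<mu> (e_fun s) = 1" by (simp add: Lp_norm_def prob_space)
qed

lemma Lp_semi_inner_e_fun:
  assumes "prob_space \<mu>" and "sets \<mu> = sets borel"
  shows "Lp_semi_inner p \<mu> (e_fun s) (e_fun t) = (\<integral>x. e_fun (s - t) x \<partial>\<mu>)"
proof -
  have "sgn (e_fun t x) = e_fun t x" for x by (simp add: sgn_eq)
  then show ?thesis
    by (simp add: Lp_semi_inner_def e_fun_in_Lp[OF assms] e_fun_mult_cnj)
qed

text \<open>Dominated convergence makes the Fourier transform continuous at the origin, where its value
  is the total mass \<open>1\<close>.\<close>

lemma fourier_transform_lower_bound_near_0:
  fixes \<mu> :: "(real ^ 'n) measure"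
  assumes "prob_space \<mu>" and "sets \<mu> = sets borel"
  obtains \<delta> where "\<delta> > 0" and "\<And>u. norm u \<le> \<delta> \<Longrightarrow> 1 / 2 \<le> cmod (\<integral>x. e_fun u x \<partial>\<mu>)"
proof -
  interpret prob_space \<mu> by fact
  define F where "F u = (\<integral>x. e_fun u x \<partial>\<mu>)" for u :: "real ^ 'n"
  have meas: "e_fun u \<in> borel_measurable \<mu>" for u :: "real ^ 'n"
    using borel_measurable_e_fun assms(2) measurable_cong_sets by blast
  have "isCont F 0"
    unfolding continuous_at_sequentially comp_def
  proof (intro allI impI)
    fix u :: "nat \<Rightarrow> real ^ 'n" assume u: "u \<longlonglongrightarrow> 0"
    show "(\<lambda>k. F (u k)) \<longlonglongrightarrow> F 0"
      unfolding F_def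
    proof (rule integral_dominated_convergence[where w = "\<lambda>_. 1"])
      have "(\<lambda>k. e_fun (u k) x) \<longlonglongrightarrow> e_fun 0 x" for x
        unfolding e_fun_def by (intro tendsto_intros u)
      then show "AE x in \<mu>. (\<lambda>k. e_fun (u k) x) \<longlonglongrightarrow> e_fun 0 x" by simp
    qed (use meas in auto)
  qed
  moreover have "F 0 = 1" by (simp add: F_def e_fun_def prob_space)
  ultimately obtain r where r: "r > 0" and near: "\<And>u. dist u 0 < r \<Longrightarrow> dist (F u) 1 < 1 / 2"
    unfolding continuous_at_eps_delta by (metis half_gt_zero zero_less_one)
  show ?thesis
  proof (rule that[of "r / 2"])
    fix u :: "real ^ 'n" assume "norm u \<le> r / 2"
    then have "cmod (1 - F u) < 1 / 2"
      using near[of u] r by (simp add: dist_norm norm_minus_commute)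
    then show "1 / 2 \<le> cmod (\<integral>x. e_fun u x \<partial>\<mu>)"
      using norm_triangle_ineq2[of 1 "1 - F u"] by (simp add: F_def)
  qed (use r in simp)
qed

text \<open>Markov's inequality for \<open>|[e\<^sub>s, e\<^sub>t]|\<^sup>q\<close> on the ball of radius \<open>\<delta>\<close>, with \<open>\<delta>\<close>
  taken from the Fourier transform of \<open>\<mu>\<close>; this radius does not depend on the centre because
  \<open>[e\<^sub>s, e\<^sub>t]\<close> only depends on \<open>s - t\<close>.\<close>

lemma Bessel_measure_uniform_ball_bound:
  fixes \<mu> \<nu> :: "(real ^ 'n) measure"
  assumes "prob_space \<mu>" and "sets \<mu> = sets borel" and "q > 0" and "Bessel_measure p q \<mu> \<nu>"
  obtains \<delta> M where "\<delta> > 0" and "M \<ge> 0" and "\<And>s. emeasure \<nu> (cball s \<delta>) \<le> ennreal M"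
proof -
  obtain \<delta> where \<delta>: "\<delta> > 0" "\<And>u :: real ^ 'n. norm u \<le> \<delta> \<Longrightarrow> 1 / 2 \<le> cmod (\<integral>x. e_fun u x \<partial>\<mu>)"
    using fourier_transform_lower_bound_near_0[OF assms(1,2)] by blast
  obtain B where B: "B > 0" and sets: "sets \<nu> = sets borel" and
    bessel: "\<And>f. in_Lp p \<mu> f \<Longrightarrow>
        (\<integral>\<^sup>+t. ennreal (cmod (Lp_semi_inner p \<mu> f (e_fun t)) powr q) \<partial>\<nu>)
          \<le> ennreal (B * Lp_norm p \<mu> f powr q)"
    using assms(4) unfolding Bessel_measure_def by blast
  have "emeasure \<nu> (cball s \<delta>) \<le> ennreal (2 powr q * B)" for s
  proof -
    have cball: "cball s \<delta> \<in> sets \<nu>" using sets by simp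
    have "ennreal ((1 / 2) powr q) * emeasure \<nu> (cball s \<delta>)
        = (\<integral>\<^sup>+t. ennreal ((1 / 2) powr q) * indicator (cball s \<delta>) t \<partial>\<nu>)"
      using cball by (simp add: nn_integral_cmult_indicator)
    also have "\<dots> \<le> (\<integral>\<^sup>+t. ennreal (cmod (Lp_semi_inner p \<mu> (e_fun s) (e_fun t)) powr q) \<partial>\<nu>)"
    proof (rule nn_integral_mono)
      fix t
      have "(1 / 2) powr q \<le> cmod (Lp_semi_inner p \<mu> (e_fun s) (e_fun t)) powr q"
        if "t \<in> cball s \<delta>"
        using \<delta>(2)[of "s - t"] that \<open>q > 0\<close> unfolding Lp_semi_inner_e_fun[OF assms(1,2)]
        by (intro powr_mono2) (auto simp: dist_norm)
      then show "ennreal ((1 / 2) powr q) * indicator (cball s \<delta>) t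
          \<le> ennreal (cmod (Lp_semi_inner p \<mu> (e_fun s) (e_fun t)) powr q)"
        by (simp add: indicator_def ennreal_leI)
    qed
    also have "\<dots> \<le> ennreal B"
      using bessel[OF e_fun_in_Lp(1)[OF assms(1,2)], of s] by (simp add: e_fun_in_Lp(2)[OF assms(1,2)])
    finally have le: "ennreal ((1 / 2) powr q) * emeasure \<nu> (cball s \<delta>) \<le> ennreal B" .
    have "emeasure \<nu> (cball s \<delta>)
        = ennreal (2 powr q) * (ennreal ((1 / 2) powr q) * emeasure \<nu> (cball s \<delta>))"
      by (simp add: mult.assoc[symmetric] ennreal_mult[symmetric] powr_mult[symmetric])
    also have "\<dots> \<le> ennreal (2 powr q) * ennreal B" by (rule mult_left_mono[OF le]) simp
    finally show ?thesis using B by (simp add: ennreal_mult)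
  qed
  then show ?thesis using that[of \<delta> "2 powr q * B"] \<delta>(1) B by simp
qed

text \<open>Rounding every coordinate down to a grid of mesh \<open>\<delta> / d\<close> moves a point by at most \<open>\<delta>\<close>,
  because the Euclidean norm is at most the sum of the \<open>d\<close> coordinates in absolute value. Relative to
  a point of the set, only \<open>O(D / \<delta> + 1)\<close> grid values occur in each coordinate.\<close>

lemma bounded_grid_cover:
  fixes K :: "(real ^ 'n) set"
  assumes "bounded K" and "\<delta> > 0"
  obtains S where "finite S" and "K \<subseteq> (\<Union>s\<in>S. cball s \<delta>)"
    and "real (card S) \<le> ((2 * CARD('n) / \<delta> + 3) * max 1 (diameter K)) ^ CARD('n)"
proof (cases "K = {}")
  case True
  show ?thesis
    by (rule that[of "{}"]) (use True \<open>\<delta> > 0\<close> in auto)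
next
  case False
  then obtain a where a: "a \<in> K" by blast
  define D where "D = diameter K"
  define \<eta> where "\<eta> = \<delta> / CARD('n)"
  define N where "N = \<lceil>D / \<eta>\<rceil>"
  define I where "I = (UNIV :: 'n set) \<rightarrow>\<^sub>E {-N..N}"
  define g where "g k = a + (\<chi> i. \<eta> * of_int (k i))" for k :: "'n \<Rightarrow> int"
  have \<eta>: "\<eta> > 0" using \<open>\<delta> > 0\<close> by (simp add: \<eta>_def)
  have D: "D \<ge> 0" unfolding D_def by (rule diameter_ge_0[OF assms(1)])
  have "0 \<le> D / \<eta>" using D \<eta> by simp
  then have N: "N \<ge> 0" "of_int N \<le> D / \<eta> + 1" unfolding N_def by linarith+
  have fin: "finite I" unfolding I_def by (intro finite_PiE) auto
  show ?thesis
  proof (rule that[of "g ` I"])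
    show "finite (g ` I)" using fin by simp
    show "K \<subseteq> (\<Union>s\<in>g ` I. cball s \<delta>)"
    proof
      fix x assume x: "x \<in> K"
      define k where "k i = \<lfloor>(x $ i - a $ i) / \<eta>\<rfloor>" for i
      have "k i \<in> {-N..N}" for i
      proof -
        have "\<bar>x $ i - a $ i\<bar> \<le> norm (x - a)" using component_le_norm_cart[of "x - a" i] by simp
        also have "\<dots> \<le> D"
          unfolding D_def using diameter_bounded_bound[OF assms(1) x a] by (simp add: dist_norm)
        finally have "\<bar>(x $ i - a $ i) / \<eta>\<bar> \<le> D / \<eta>" using \<eta> by (simp add: divide_right_mono)
        also have "\<dots> \<le> of_int N" unfolding N_def by (rule le_of_int_ceiling)
        finally have "- of_int N \<le> (x $ i - a $ i) / \<eta>" "(x $ i - a $ i) / \<eta> \<le> of_int N" by linarith+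
        then show ?thesis unfolding k_def by (auto simp: le_floor_iff floor_le_iff)
      qed
      then have "k \<in> I" by (auto simp: I_def PiE_def Pi_def extensional_def)
      moreover have "dist (g k) x \<le> \<delta>"
      proof -
        have "\<bar>(x - g k) $ i\<bar> \<le> \<eta>" for i
        proof -
          have "(x - g k) $ i = \<eta> * ((x $ i - a $ i) / \<eta> - of_int (k i))"
            using \<eta> by (simp add: g_def field_simps)
          moreover have "\<bar>(x $ i - a $ i) / \<eta> - of_int (k i)\<bar> \<le> 1" unfolding k_def by linarith
          ultimately show ?thesis using \<eta> by (simp add: abs_mult mult_left_le)
        qed
        then have "norm (x - g k) \<le> (\<Sum>i\<in>(UNIV :: 'n set). \<eta>)"
          by (intro order_trans[OF norm_le_l1_cart] sum_mono)
        also have "\<dots> = \<delta>" by (simp add: \<eta>_def)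
        finally show ?thesis by (simp add: dist_norm norm_minus_commute)
      qed
      ultimately show "x \<in> (\<Union>s\<in>g ` I. cball s \<delta>)" by auto
    qed
    have "real (card (g ` I)) \<le> real (card I)" using card_image_le[OF fin] by simp
    also have "card I = nat (2 * N + 1) ^ CARD('n)"
      unfolding I_def using N(1) by (subst card_PiE) (auto simp: algebra_simps)
    also have "real \<dots> = (2 * of_int N + 1) ^ CARD('n)" using N(1) by simp
    also have "\<dots> \<le> ((2 * CARD('n) / \<delta> + 3) * max 1 D) ^ CARD('n)"
    proof (rule power_mono)
      have "2 * of_int N + 1 \<le> (2 / \<eta>) * D + 3" using N(2) by simp
      also have "\<dots> \<le> (2 / \<eta>) * max 1 D + 3 * max 1 D"
        using \<eta> by (intro add_mono mult_left_mono) auto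
      also have "\<dots> = (2 * CARD('n) / \<delta> + 3) * max 1 D" by (simp add: \<eta>_def algebra_simps)
      finally show "2 * of_int N + 1 \<le> (2 * CARD('n) / \<delta> + 3) * max 1 D" .
    qed (use N(1) in simp)
    finally show "real (card (g ` I)) \<le> ((2 * CARD('n) / \<delta> + 3) * max 1 (diameter K)) ^ CARD('n)"
      by (simp add: D_def)
  qed
qed

lemma uniform_ball_bound_imp_growth:
  fixes \<nu> :: "(real ^ 'n) measure"
  assumes "sets \<nu> = sets borel" and "\<delta> > 0" and "M \<ge> 0"
    and ball: "\<And>s. emeasure \<nu> (cball s \<delta>) \<le> ennreal M"
    and "bounded K"
  shows "emeasure \<nu> K
    \<le> ennreal (M * (2 * CARD('n) / \<delta> + 3) ^ CARD('n) * max 1 (diameter K) ^ CARD('n))"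
proof -
  obtain S where S: "finite S" "K \<subseteq> (\<Union>s\<in>S. cball s \<delta>)"
    "real (card S) \<le> ((2 * CARD('n) / \<delta> + 3) * max 1 (diameter K)) ^ CARD('n)"
    using bounded_grid_cover[OF \<open>bounded K\<close> \<open>\<delta> > 0\<close>] by blast
  have "emeasure \<nu> K \<le> emeasure \<nu> (\<Union>s\<in>S. cball s \<delta>)"
    using S(1,2) assms(1) by (intro emeasure_mono) auto
  also have "\<dots> \<le> (\<Sum>s\<in>S. emeasure \<nu> (cball s \<delta>))"
    by (rule emeasure_subadditive_finite[OF S(1)]) (simp add: assms(1) image_subset_iff)
  also have "\<dots> \<le> (\<Sum>s\<in>S. ennreal M)" by (intro sum_mono ball)
  also have "\<dots> = ennreal (M * real (card S))"
    using \<open>M \<ge> 0\<close> by (simp add: ennreal_mult ennreal_of_nat_eq_real_of_nat mult.commute)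
  also have "\<dots> \<le> ennreal (M * ((2 * CARD('n) / \<delta> + 3) * max 1 (diameter K)) ^ CARD('n))"
    using S(3) \<open>M \<ge> 0\<close> by (intro ennreal_leI mult_left_mono)
  finally show ?thesis by (simp add: power_mult_distrib mult.assoc)
qed

lemma sigma_finite_measure_if_finite_on_compact:
  fixes \<nu> :: "'a :: heine_borel measure"
  assumes "sets \<nu> = sets borel" and "\<And>K. compact K \<Longrightarrow> emeasure \<nu> K < \<infinity>"
  shows "sigma_finite_measure \<nu>"
proof
  have "(\<Union>k :: nat. cball undefined (real k)) = (UNIV :: 'a set)"
    using real_arch_simple by auto
  moreover have "space \<nu> = UNIV" using sets_eq_imp_space_eq[OF assms(1)] by simp
  ultimately show "\<exists>A. countable A \<and> A \<subseteq> sets \<nu> \<and> \<Union> A = space \<nu> \<and> (\<forall>a\<in>A. emeasure \<nu> a \<noteq> \<infinity>)"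
    using assms
    by (intro exI[of _ "range (\<lambda>k :: nat. cball (undefined :: 'a) (real k))"])
       (auto simp: less_top)
qed

theorem proposition4p1:
  fixes \<mu> \<nu> :: "(real ^ 'n) measure" and p q :: real
  assumes "prob_space \<mu>" and "sets \<mu> = sets borel"
    and "1 < p" and "1 < q" and "1 / p + 1 / q = 1"
    and "Bessel_measure p q \<mu> \<nu>"
  shows "(\<exists>C::real. \<forall>K. compact K \<longrightarrow>
            emeasure \<nu> K \<le> ennreal (C * max 1 (diameter K) ^ CARD('n)))
         \<and> sigma_finite_measure \<nu>"
proof -
  have sets: "sets \<nu> = sets borel" using assms(6) by (simp add: Bessel_measure_def)
  have "q > 0" using assms(4) by simp
  obtain \<delta> M where "\<delta> > 0" "M \<ge> 0" "\<And>s. emeasure \<nu> (cball s \<delta>) \<le> ennreal M"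
    using Bessel_measure_uniform_ball_bound[OF assms(1,2) \<open>q > 0\<close> assms(6)] by blast
  from uniform_ball_bound_imp_growth[OF sets this]
  have growth: "emeasure \<nu> K
      \<le> ennreal (M * (2 * CARD('n) / \<delta> + 3) ^ CARD('n) * max 1 (diameter K) ^ CARD('n))"
    if "compact K" for K
    using that compact_imp_bounded by blast
  have "sigma_finite_measure \<nu>"
  proof (rule sigma_finite_measure_if_finite_on_compact[OF sets])
    show "emeasure \<nu> K < \<infinity>" if "compact K" for K
      using le_less_trans[OF growth[OF that] ennreal_less_top] by simp
  qed
  then show ?thesis using growth by blast
qed

end
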